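(* Let $A=\ell^{1}(\mathbb{N}_{\vee})$ be the semigroup algebra of the semigroup $(\mathbb{N},\vee)$, where $m\vee n=\max\{m,n\}$. Then $A$, regarded as a Banach left $A$-module by multiplication, is $\phi$-injective for each $\phi\in\Delta(A)$.
   Context: $\mathbb{N}=\{1,2,3,\dots\}$. For a semigroup $S$, $\ell^{1}(S)$ is the Banach algebra of absolutely summable functions $f:S\to\mathbb{C}$ with norm $\|f\|_1=\sum_{s}|f(s)|$ and convolution product $(f\ast g)(s)=\sum_{uv=s}f(u)g(v)$ (an empty sum is $0$). $\Delta(A)$ is the set of characters of the Banach algebra $A$, i.e. non-zero (algebra) homomorphisms $A\to\mathbb{C}$. For Banach left $A$-modules $F,K$, $_{A}B(F,K)$ is the space of bounded linear left $A$-module morphisms $F\to K$. A bounded linear operator $T:F\to K$ is admissible if $\ker T$ and $\operatorname{Im}T$ are closed complemented subspaces of $F$ and $K$ respectively (equivalently, there is a bounded linear $S:K\to F$ with $T\circ S\circ T=T$). A monomorphism is an injective bounded module morphism. For a Banach left $A$-module $K$ and $\phi\in\Delta(A)$, $I(\phi,K)=\operatorname{span}\{a\cdot x-\phi(a)x : a\in A,\ x\in K\}$. A Banach left $A$-module $E$ is $\phi$-injective if for all Banach left $A$-modules $F,K$ and every admissible monomorphism $T\in{}_{A}B(F,K)$ with $I(\phi,K)\subseteq\operatorname{Im}T$, the map $_{A}B(K,E)\to{}_{A}B(F,E)$, $R\mapsto R\circ T$, is onto. *)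

theory Defs
  imports "HOL-Analysis.Analysis"
begin

class scaleC =
  fixes scaleC :: "complex \<Rightarrow> 'a \<Rightarrow> 'a"  (infixr "*\<^sub>C" 75)

class complex_vector = real_vector + scaleC +
  assumes scaleC_add_right: "c *\<^sub>C (x + y) = c *\<^sub>C x + c *\<^sub>C y"
    and scaleC_add_left: "(c + d) *\<^sub>C x = c *\<^sub>C x + d *\<^sub>C x"
    and scaleC_scaleC: "c *\<^sub>C d *\<^sub>C x = (c * d) *\<^sub>C x"
    and scaleC_of_real: "complex_of_real r *\<^sub>C x = r *\<^sub>R x"

class complex_banach = complex_vector + banach +
  assumes norm_scaleC: "norm (c *\<^sub>C x) = cmod c * norm x"

text \<open>Banach algebras are associative and submultiplicative, but not assumed to be unital.\<close>

class complex_banach_algebra = complex_banach + real_normed_algebra +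
  assumes mult_scaleC_left: "(c *\<^sub>C x) * y = c *\<^sub>C (x * y)"
    and mult_scaleC_right: "x * (c *\<^sub>C y) = c *\<^sub>C (x * y)"

instantiation complex :: complex_banach_algebra
begin
definition scaleC_complex :: "complex \<Rightarrow> complex \<Rightarrow> complex" where "scaleC_complex = (*)"
instance
  by standard (auto simp: scaleC_complex_def algebra_simps scaleR_conv_of_real norm_mult)
end

lemma vector_space_scaleC:
  "vector_space (scaleC :: complex \<Rightarrow> 'a \<Rightarrow> 'a::complex_vector)"
proof
  fix x :: 'a
  show "1 *\<^sub>C x = x" using scaleC_of_real[of 1 x] by simp
qed (simp_all add: scaleC_add_right scaleC_add_left scaleC_scaleC)

definition cspan :: "'a::complex_vector set \<Rightarrow> 'a set" where
  "cspan = module.span scaleC"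

definition clinear :: "('a::complex_vector \<Rightarrow> 'b::complex_vector) \<Rightarrow> bool" where
  "clinear = Vector_Spaces.linear scaleC scaleC"

definition csubspace :: "'a::complex_vector set \<Rightarrow> bool" where
  "csubspace = module.subspace scaleC"

definition bounded_clinear :: "('a::complex_banach \<Rightarrow> 'b::complex_banach) \<Rightarrow> bool" where
  "bounded_clinear T \<longleftrightarrow> clinear T \<and> bounded_linear T"

definition characters :: "('a::complex_banach_algebra \<Rightarrow> complex) set" where
  "characters = {\<phi>. clinear \<phi> \<and> (\<forall>a b. \<phi> (a * b) = \<phi> a * \<phi> b) \<and> \<phi> \<noteq> (\<lambda>_. 0)}"

text \<open>A Banach left module is given by the type of its elements together with its action.  The
  action is jointly bounded, and it is not required to be unital.\<close>

definition banach_left_module :: "('a::complex_banach_algebra \<Rightarrow> 'x::complex_banach \<Rightarrow> 'x) \<Rightarrow> bool" where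
  "banach_left_module act \<longleftrightarrow>
     (\<forall>a. clinear (act a)) \<and> (\<forall>x. clinear (\<lambda>a. act a x)) \<and>
     (\<forall>a b x. act (a * b) x = act a (act b x)) \<and>
     (\<exists>C. \<forall>a x. norm (act a x) \<le> C * norm a * norm x)"

definition module_morphisms ::
  "('a::complex_banach_algebra \<Rightarrow> 'x::complex_banach \<Rightarrow> 'x) \<Rightarrow>
   ('a \<Rightarrow> 'y::complex_banach \<Rightarrow> 'y) \<Rightarrow> ('x \<Rightarrow> 'y) set" where
  "module_morphisms actX actY =
     {T. bounded_clinear T \<and> (\<forall>a x. T (actX a x) = actY a (T x))}"

definition closed_complemented :: "'a::complex_banach set \<Rightarrow> bool" where
  "closed_complemented M \<longleftrightarrow> csubspace M \<and> closed M \<and>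
     (\<exists>N. csubspace N \<and> closed N \<and> M \<inter> N = {0} \<and> (\<forall>x. \<exists>m\<in>M. \<exists>n\<in>N. x = m + n))"

definition admissible :: "('a::complex_banach \<Rightarrow> 'b::complex_banach) \<Rightarrow> bool" where
  "admissible T \<longleftrightarrow>
     bounded_clinear T \<and> closed_complemented {x. T x = 0} \<and> closed_complemented (range T)"

definition I_char ::
  "('a::complex_banach_algebra \<Rightarrow> complex) \<Rightarrow> ('a \<Rightarrow> 'x::complex_banach \<Rightarrow> 'x) \<Rightarrow> 'x set" where
  "I_char \<phi> act = cspan {act a x - \<phi> a *\<^sub>C x | a x. True}"

text \<open>HOL formulas cannot quantify over types, so the Banach spaces underlying the test modules
  \<open>F\<close> and \<open>K\<close> are type parameters of the definition.  Injectivity of a module is stated with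
  both parameters being free type variables, which amounts to all Banach spaces \<open>F\<close> and \<open>K\<close>.\<close>

definition char_injective ::
  "'f::complex_banach itself \<Rightarrow> 'k::complex_banach itself \<Rightarrow>
   ('a::complex_banach_algebra \<Rightarrow> complex) \<Rightarrow> ('a \<Rightarrow> 'e::complex_banach \<Rightarrow> 'e) \<Rightarrow> bool" where
  "char_injective _ _ \<phi> actE \<longleftrightarrow> banach_left_module actE \<and>
     (\<forall>(actF :: 'a \<Rightarrow> 'f \<Rightarrow> 'f) (actK :: 'a \<Rightarrow> 'k \<Rightarrow> 'k) T.
        banach_left_module actF \<longrightarrow> banach_left_module actK \<longrightarrow>
        T \<in> module_morphisms actF actK \<longrightarrow> inj T \<longrightarrow> admissible T \<longrightarrow>
        I_char \<phi> actK \<subseteq> range T \<longrightarrow>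
        (\<lambda>R. R \<circ> T) ` module_morphisms actK actE = module_morphisms actF actE)"

typedef 's l1 = "{f :: 's \<Rightarrow> complex. (\<lambda>s. cmod (f s)) summable_on UNIV}"
  morphisms l1_fun Abs_l1
  by (rule exI[of _ "\<lambda>_. 0"]) simp

setup_lifting type_definition_l1

lemma summable_norm_l1 [simp]: "(\<lambda>s. cmod (l1_fun f s)) summable_on A"
  using l1_fun[of f] summable_on_subset_banach by blast

lemma l1_eqI: "(\<And>s. l1_fun f s = l1_fun g s) \<Longrightarrow> f = g"
  by (metis ext l1_fun_inject)

instantiation l1 :: (type) complex_vector
begin

lift_definition zero_l1 :: "'a l1" is "\<lambda>_. 0" by simp

lift_definition plus_l1 :: "'a l1 \<Rightarrow> 'a l1 \<Rightarrow> 'a l1" is "\<lambda>f g s. f s + g s"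
  subgoal for f g
    by (rule Infinite_Sum.abs_summable_on_comparison_test'
          [OF summable_on_add[of "\<lambda>s. cmod (f s)" UNIV "\<lambda>s. cmod (g s)"]])
      (auto intro: norm_triangle_ineq)
  done

lift_definition scaleC_l1 :: "complex \<Rightarrow> 'a l1 \<Rightarrow> 'a l1" is "\<lambda>c f s. c * f s"
  by (simp add: norm_mult summable_on_cmult_right)

lift_definition scaleR_l1 :: "real \<Rightarrow> 'a l1 \<Rightarrow> 'a l1" is "\<lambda>r f s. of_real r * f s"
  by (simp add: norm_mult summable_on_cmult_right)

lift_definition uminus_l1 :: "'a l1 \<Rightarrow> 'a l1" is "\<lambda>f s. - f s" by simp

lift_definition minus_l1 :: "'a l1 \<Rightarrow> 'a l1 \<Rightarrow> 'a l1" is "\<lambda>f g s. f s - g s"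
  subgoal for f g
    by (rule Infinite_Sum.abs_summable_on_comparison_test'
          [OF summable_on_add[of "\<lambda>s. cmod (f s)" UNIV "\<lambda>s. cmod (g s)"]])
      (auto intro: norm_triangle_ineq4)
  done

instance
  by standard (transfer; force simp: algebra_simps)+

end

instantiation l1 :: (type) real_normed_vector
begin

definition norm_l1 :: "'a l1 \<Rightarrow> real" where
  "norm_l1 f = (\<Sum>\<^sub>\<infinity>s. cmod (l1_fun f s))"
definition dist_l1 :: "'a l1 \<Rightarrow> 'a l1 \<Rightarrow> real" where
  "dist_l1 f g = norm (f - g)"
definition sgn_l1 :: "'a l1 \<Rightarrow> 'a l1" where
  "sgn_l1 f = inverse (norm f) *\<^sub>R f"
definition uniformity_l1 :: "('a l1 \<times> 'a l1) filter" where
  "uniformity_l1 = (INF e\<in>{0<..}. principal {(x, y). dist x y < e})"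
definition open_l1 :: "'a l1 set \<Rightarrow> bool" where
  "open_l1 U \<longleftrightarrow> (\<forall>x\<in>U. eventually (\<lambda>(x', y). x' = x \<longrightarrow> y \<in> U) uniformity)"

lemma norm_l1_ge: "finite A \<Longrightarrow> (\<Sum>s\<in>A. cmod (l1_fun f s)) \<le> norm f"
  unfolding norm_l1_def by (rule finite_sum_le_infsum) auto

lemma norm_l1_le: "(\<And>A. finite A \<Longrightarrow> (\<Sum>s\<in>A. cmod (l1_fun f s)) \<le> C) \<Longrightarrow> norm f \<le> C"
  unfolding norm_l1_def by (rule infsum_le_finite_sums) auto

lemma norm_l1_scaleC: "norm (c *\<^sub>C f) = cmod c * norm (f :: 'a l1)"
  by (simp add: norm_l1_def scaleC_l1.rep_eq norm_mult infsum_cmult_right')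

lemma norm_l1_triangle: "norm (f + g) \<le> norm f + norm (g :: 'a l1)"
proof (rule norm_l1_le)
  fix A :: "'a set" assume A: "finite A"
  have "(\<Sum>s\<in>A. cmod (l1_fun (f + g) s)) \<le> (\<Sum>s\<in>A. cmod (l1_fun f s)) + (\<Sum>s\<in>A. cmod (l1_fun g s))"
    by (simp add: plus_l1.rep_eq sum.distrib[symmetric] sum_mono norm_triangle_ineq)
  with norm_l1_ge[OF A, of f] norm_l1_ge[OF A, of g]
  show "(\<Sum>s\<in>A. cmod (l1_fun (f + g) s)) \<le> norm f + norm g" by linarith
qed

lemma norm_l1_eq_0: "norm (f :: 'a l1) = 0 \<longleftrightarrow> f = 0"
proof
  assume 0: "norm f = 0"
  show "f = 0"
    by (rule l1_eqI) (use norm_l1_ge[of "{_}" f] 0 in \<open>simp add: zero_l1.rep_eq\<close>)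
qed (simp add: norm_l1_def zero_l1.rep_eq)

instance
proof
  fix x y :: "'a l1" and a :: real
  show "norm (a *\<^sub>R x) = \<bar>a\<bar> * norm x"
    by (metis scaleC_of_real norm_l1_scaleC norm_of_real)
qed (simp_all add: dist_l1_def sgn_l1_def uniformity_l1_def open_l1_def norm_l1_eq_0 norm_l1_triangle)

end

lemma Cauchy_l1_convergent:
  fixes X :: "nat \<Rightarrow> 'a l1"
  assumes X: "\<And>e. e > 0 \<Longrightarrow> \<exists>M. \<forall>m\<ge>M. \<forall>n\<ge>M. norm (X m - X n) < e"
  shows "\<exists>L. \<forall>e>0. \<exists>M. \<forall>n\<ge>M. norm (X n - L) \<le> e"
proof -
  have pt: "cmod (l1_fun f s) \<le> norm f" for f :: "'a l1" and s
    using norm_l1_ge[of "{s}" f] by simp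
  have "Cauchy (\<lambda>n. l1_fun (X n) s)" for s
  proof (rule metric_CauchyI)
    fix e :: real assume "e > 0"
    then obtain M where "\<forall>m\<ge>M. \<forall>n\<ge>M. norm (X m - X n) < e" using X by blast
    then show "\<exists>M. \<forall>m\<ge>M. \<forall>n\<ge>M. dist (l1_fun (X m) s) (l1_fun (X n) s) < e"
      by (metis pt dist_norm minus_l1.rep_eq order_le_less_trans)
  qed
  then have "\<exists>l. (\<lambda>n. l1_fun (X n) s) \<longlonglongrightarrow> l" for s
    using Cauchy_convergent convergent_def by blast
  then obtain g where g: "\<And>s. (\<lambda>n. l1_fun (X n) s) \<longlonglongrightarrow> g s" by metis
  have bound: "(\<Sum>s\<in>A. cmod (l1_fun (X n) s - g s)) \<le> e"
    if M: "\<forall>m\<ge>M. \<forall>n\<ge>M. norm (X m - X n) < e" and "n \<ge> M" "finite A" for e M n A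
  proof (rule LIMSEQ_le_const2)
    show "(\<lambda>m. \<Sum>s\<in>A. cmod (l1_fun (X n) s - l1_fun (X m) s)) \<longlonglongrightarrow> (\<Sum>s\<in>A. cmod (l1_fun (X n) s - g s))"
      by (intro tendsto_intros g)
    have "(\<Sum>s\<in>A. cmod (l1_fun (X n) s - l1_fun (X m) s)) \<le> e" if "m \<ge> M" for m
      using norm_l1_ge[OF \<open>finite A\<close>, of "X n - X m"] M[rule_format, OF \<open>n \<ge> M\<close> that]
      by (simp add: minus_l1.rep_eq)
    then show "\<exists>N. \<forall>m\<ge>N. (\<Sum>s\<in>A. cmod (l1_fun (X n) s - l1_fun (X m) s)) \<le> e" by blast
  qed
  have sum_diff: "(\<lambda>s. cmod (l1_fun (X n) s - g s)) summable_on UNIV"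
    if M: "\<forall>m\<ge>M. \<forall>n\<ge>M. norm (X m - X n) < e" and "n \<ge> M" for e M n
    unfolding abs_summable_iff_bdd_above
    by (rule bdd_aboveI[of _ e]) (use bound[OF that] in auto)
  obtain M0 where M0: "\<forall>m\<ge>M0. \<forall>n\<ge>M0. norm (X m - X n) < 1" using X[of 1] by auto
  have "(\<lambda>s. cmod (g s)) summable_on UNIV"
  proof (rule Infinite_Sum.abs_summable_on_comparison_test')
    show "(\<lambda>s. cmod (l1_fun (X M0) s) + cmod (l1_fun (X M0) s - g s)) summable_on UNIV"
      by (intro summable_on_add sum_diff[OF M0] order.refl) simp
    show "cmod (g s) \<le> cmod (l1_fun (X M0) s) + cmod (l1_fun (X M0) s - g s)" for s
      by (metis norm_minus_commute norm_triangle_sub)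
  qed
  then have L: "l1_fun (Abs_l1 g) = g" by (simp add: Abs_l1_inverse)
  show ?thesis
  proof (intro exI[of _ "Abs_l1 g"] allI impI)
    fix e :: real assume "e > 0"
    then obtain M where M: "\<forall>m\<ge>M. \<forall>n\<ge>M. norm (X m - X n) < e" using X by blast
    have "norm (X n - Abs_l1 g) \<le> e" if "n \<ge> M" for n
      by (rule norm_l1_le) (use bound[OF M that] in \<open>simp add: minus_l1.rep_eq L\<close>)
    then show "\<exists>M. \<forall>n\<ge>M. norm (X n - Abs_l1 g) \<le> e" by blast
  qed
qed

instance l1 :: (type) complex_banach
proof
  fix X :: "nat \<Rightarrow> 'a l1"
  assume "Cauchy X"
  then have "\<exists>M. \<forall>m\<ge>M. \<forall>n\<ge>M. norm (X m - X n) < e" if "e > 0" for e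
    using that by (simp add: Cauchy_def dist_norm)
  from Cauchy_l1_convergent[OF this] obtain L
    where L: "\<forall>e>0. \<exists>M. \<forall>n\<ge>M. norm (X n - L) \<le> e" by blast
  have "X \<longlonglongrightarrow> L"
  proof (rule LIMSEQ_I)
    fix e :: real assume "e > 0"
    with L obtain M where "\<forall>n\<ge>M. norm (X n - L) \<le> e / 2" by (meson half_gt_zero)
    with \<open>e > 0\<close> show "\<exists>M. \<forall>n\<ge>M. norm (X n - L) < e" by (intro exI[of _ M]) fastforce
  qed
  then show "convergent X" by (rule convergentI)
qed (rule norm_l1_scaleC)

lemma l1_product_summable:
  assumes "(\<lambda>u. cmod (f u)) summable_on UNIV" "(\<lambda>v. cmod (g v)) summable_on UNIV"
  shows "(\<lambda>p. cmod (f (fst p) * g (snd p))) summable_on UNIV"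
proof -
  have "(\<lambda>v. cmod (f u * g v)) summable_on UNIV" for u
    using assms by (simp add: norm_mult summable_on_cmult_right)
  moreover have "(\<lambda>u. \<Sum>\<^sub>\<infinity>v. cmod (f u * g v)) summable_on UNIV"
    using assms by (simp add: norm_mult infsum_cmult_right' summable_on_cmult_left)
  ultimately show ?thesis
    using Infinite_Sum.abs_summable_on_Sigma_iff
        [where f = "\<lambda>p. f (fst p) * g (snd p)" and A = UNIV and B = "\<lambda>_. UNIV"]
    by (simp add: infsum_nonneg)
qed

definition convolution :: "('s::times \<Rightarrow> complex) \<Rightarrow> ('s \<Rightarrow> complex) \<Rightarrow> 's \<Rightarrow> complex" where
  "convolution f g s = (\<Sum>\<^sub>\<infinity>(u, v) \<in> {(u, v). u * v = s}. f u * g v)"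

lemma bij_fibres: "bij_betw snd (SIGMA s:UNIV. {(u, v). u * v = s}) (UNIV :: ('s::times \<times> 's) set)"
  by (auto simp: bij_betw_def inj_on_def image_iff)

lemma conv_summable_and_norm:
  fixes f g :: "'s::times \<Rightarrow> complex"
  assumes fg: "(\<lambda>u. cmod (f u)) summable_on UNIV" "(\<lambda>v. cmod (g v)) summable_on UNIV"
  shows "(\<lambda>s. cmod (convolution f g s)) summable_on UNIV"
    and "(\<Sum>\<^sub>\<infinity>s. cmod (convolution f g s)) \<le> (\<Sum>\<^sub>\<infinity>u. cmod (f u)) * (\<Sum>\<^sub>\<infinity>v. cmod (g v))"
proof -
  let ?h = "\<lambda>p. cmod (f (fst p) * g (snd p))"
  let ?F = "\<lambda>s :: 's. {(u, v). u * v = s}"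
  have h: "?h summable_on UNIV" by (rule l1_product_summable[OF fg])
  then have h': "?h summable_on A" for A using summable_on_subset_banach by blast
  have S: "(\<lambda>q. ?h (snd q)) summable_on Sigma UNIV ?F"
    using h by (subst summable_on_reindex_bij_betw[OF bij_fibres])
  have le: "cmod (convolution f g s) \<le> (\<Sum>\<^sub>\<infinity>p\<in>?F s. ?h p)" for s
    using norm_infsum_bound[OF h'[of "?F s"]] by (simp add: convolution_def case_prod_unfold)
  have sF: "(\<lambda>s. \<Sum>\<^sub>\<infinity>p\<in>?F s. ?h p) summable_on UNIV"
    using summable_on_SigmaD[OF S] h' by auto
  show c: "(\<lambda>s. cmod (convolution f g s)) summable_on UNIV"
    by (rule Infinite_Sum.abs_summable_on_comparison_test'[OF sF le])
  have "(\<Sum>\<^sub>\<infinity>s. cmod (convolution f g s)) \<le> (\<Sum>\<^sub>\<infinity>s. \<Sum>\<^sub>\<infinity>p\<in>?F s. ?h p)"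
    by (rule infsum_mono[OF c sF le])
  also have "\<dots> = (\<Sum>\<^sub>\<infinity>q\<in>Sigma UNIV ?F. ?h (snd q))"
    using infsum_Sigma_banach[OF S] by simp
  also have "\<dots> = (\<Sum>\<^sub>\<infinity>p. ?h p)"
    by (rule infsum_reindex_bij_betw[OF bij_fibres])
  also have "\<dots> = (\<Sum>\<^sub>\<infinity>u. \<Sum>\<^sub>\<infinity>v. cmod (f u) * cmod (g v))"
    using infsum_Sigma_banach[of ?h UNIV "\<lambda>_. UNIV"] h by (simp add: norm_mult)
  also have "\<dots> = (\<Sum>\<^sub>\<infinity>u. cmod (f u)) * (\<Sum>\<^sub>\<infinity>v. cmod (g v))"
    by (simp add: infsum_cmult_right' infsum_cmult_left')
  finally show "(\<Sum>\<^sub>\<infinity>s. cmod (convolution f g s)) \<le> (\<Sum>\<^sub>\<infinity>u. cmod (f u)) * (\<Sum>\<^sub>\<infinity>v. cmod (g v))" .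
qed

lemma conv_fibre_summable:
  assumes "(\<lambda>u. cmod (f u)) summable_on UNIV" "(\<lambda>v. cmod (g v)) summable_on UNIV"
  shows "(\<lambda>(u, v). f u * g v) summable_on A"
proof -
  have "(\<lambda>p. cmod (f (fst p) * g (snd p))) summable_on A"
    using l1_product_summable[OF assms] summable_on_subset_banach by blast
  then show ?thesis by (auto dest: abs_summable_summable simp: case_prod_unfold)
qed

lemma conv_assoc:
  fixes f g h :: "'s::semigroup_mult \<Rightarrow> complex"
  assumes f: "(\<lambda>u. cmod (f u)) summable_on UNIV" and g: "(\<lambda>u. cmod (g u)) summable_on UNIV"
    and h: "(\<lambda>u. cmod (h u)) summable_on UNIV"
  shows "convolution (convolution f g) h s = convolution f (convolution g h) s"
proof -
  let ?H = "\<lambda>(u, v, w). f u * g v * h w"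
  let ?F = "\<lambda>s :: 's. {(u, v). u * v = s}"
  let ?T = "{(u, v, w). u * v * w = s}"
  let ?L = "SIGMA p:?F s. ?F (fst p)" and ?R = "SIGMA p:?F s. ?F (snd p)"
  let ?l = "\<lambda>(p :: 's \<times> 's, q :: 's \<times> 's). (fst q, snd q, snd p)"
  let ?r = "\<lambda>(p :: 's \<times> 's, q :: 's \<times> 's). (fst p, fst q, snd q)"
  have "(\<lambda>p. cmod (f (fst p) * (\<lambda>q. g (fst q) * h (snd q)) (snd p))) summable_on UNIV"
    by (rule l1_product_summable[OF f l1_product_summable[OF g h]])
  then have "(\<lambda>p. cmod (?H p)) summable_on UNIV"
    by (simp add: case_prod_unfold mult.assoc)
  then have H: "?H summable_on A" for A
    using summable_on_subset_banach[of _ UNIV A] abs_summable_summable[of ?H A] by blast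
  have l: "bij_betw ?l ?L ?T"
    by (rule bij_betwI[where g = "\<lambda>(u, v, w). ((u * v, w), (u, v))"]) auto
  have r: "bij_betw ?r ?R ?T"
    by (rule bij_betwI[where g = "\<lambda>(u, v, w). ((u, v * w), (v, w))"]) (auto simp: mult.assoc)
  have "convolution (convolution f g) h s = (\<Sum>\<^sub>\<infinity>p\<in>?F s. \<Sum>\<^sub>\<infinity>q\<in>?F (fst p). ?H (?l (p, q)))"
    by (simp add: convolution_def case_prod_unfold infsum_cmult_left')
  also have "\<dots> = (\<Sum>\<^sub>\<infinity>x\<in>?L. ?H (?l x))"
    by (rule infsum_Sigma_banach[where f = "\<lambda>x. ?H (?l x)"]) (subst summable_on_reindex_bij_betw[OF l], rule H)
  also have "\<dots> = infsum ?H ?T" by (rule infsum_reindex_bij_betw[OF l])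
  also have "\<dots> = (\<Sum>\<^sub>\<infinity>x\<in>?R. ?H (?r x))" by (rule infsum_reindex_bij_betw[OF r, symmetric])
  also have "\<dots> = (\<Sum>\<^sub>\<infinity>p\<in>?F s. \<Sum>\<^sub>\<infinity>q\<in>?F (snd p). ?H (?r (p, q)))"
    by (rule infsum_Sigma_banach[where f = "\<lambda>x. ?H (?r x)", symmetric])
      (subst summable_on_reindex_bij_betw[OF r], rule H)
  also have "\<dots> = convolution f (convolution g h) s"
    by (simp add: convolution_def case_prod_unfold mult.assoc infsum_cmult_right')
  finally show ?thesis .
qed

instantiation l1 :: (semigroup_mult) complex_banach_algebra
begin

lift_definition times_l1 :: "'a l1 \<Rightarrow> 'a l1 \<Rightarrow> 'a l1" is convolution
  by (rule conv_summable_and_norm)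

instance
proof
  fix x y z :: "'a l1" and c :: complex and r :: real
  show "x * y * z = x * (y * z)"
    by transfer (auto simp: conv_assoc)
  show left: "(x + y) * z = x * z + y * z"
    by transfer (auto simp: convolution_def case_prod_unfold algebra_simps
        intro!: infsum_add conv_fibre_summable[unfolded case_prod_unfold])
  show right: "x * (y + z) = x * y + x * z"
    by transfer (auto simp: convolution_def case_prod_unfold algebra_simps
        intro!: infsum_add conv_fibre_summable[unfolded case_prod_unfold])
  show l: "c *\<^sub>C x * y = c *\<^sub>C (x * y)" for c
    by transfer (auto simp: convolution_def case_prod_unfold mult.assoc infsum_cmult_right')
  show r: "x * c *\<^sub>C y = c *\<^sub>C (x * y)" for c
    by transfer (auto simp: convolution_def case_prod_unfold mult.left_commute infsum_cmult_right')
  show "r *\<^sub>R x * y = r *\<^sub>R (x * y)" "x * r *\<^sub>R y = r *\<^sub>R (x * y)"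
    using l[of "of_real r"] r[of "of_real r"] by (simp_all add: scaleC_of_real)
  show "norm (x * y) \<le> norm x * norm y"
    unfolding norm_l1_def times_l1.rep_eq by (rule conv_summable_and_norm) simp_all
qed

end

typedef nat_vee = "{n :: nat. 1 \<le> n}"
  by auto

setup_lifting type_definition_nat_vee

instantiation nat_vee :: semigroup_mult
begin

lift_definition times_nat_vee :: "nat_vee \<Rightarrow> nat_vee \<Rightarrow> nat_vee" is max by simp

instance by standard (transfer, simp add: max.assoc)

end

end

theory Submission
  imports Defs
begin

text \<open>
  Let \<open>T : F \<rightarrow> K\<close> be an admissible monomorphism with left inverse \<open>L\<close>, and let \<open>S : F \<rightarrow> E\<close> be a
  morphism.  For each \<open>x\<close> in \<open>K\<close>, the map \<open>D x a = S (L (a x - \<phi>(a) x))\<close> is a derivation in \<open>a\<close>,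
  \<open>D x (a b) = a (D x b) + \<phi>(b) (D x a)\<close>, and \<open>S\<close> extends to \<open>K\<close> once these derivations are inner,
  \<open>D x a = a r(x) - \<phi>(a) r(x)\<close>, with \<open>r\<close> bounded linear: take
  \<open>R x = S (L x) + r (x - T (L x))\<close>.

  Write \<open>\<delta>\<^sub>k\<close> for the point masses, which are idempotents, so \<open>\<phi>(\<delta>\<^sub>k)\<close> is 0 or 1.  If
  \<open>\<phi>(\<delta>\<^sub>m) = 1\<close> and \<open>\<phi>(\<delta>\<^bsub>m+1\<^esub>) = 0\<close> for some \<open>m\<close>, then \<open>p = \<delta>\<^sub>m - \<delta>\<^bsub>m+1\<^esub>\<close> satisfies \<open>a p = \<phi>(a) p\<close>
  and \<open>\<phi>(p) = 1\<close>, and \<open>r(x) = - D x p\<close> works.  Otherwise \<open>\<phi>(\<delta>\<^sub>k) = 1\<close> for all \<open>k\<close>.  Then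
  commutativity gives \<open>D x a - \<delta>\<^sub>k (D x a) = \<phi>(a) (D x \<delta>\<^sub>k) - a (D x \<delta>\<^sub>k)\<close>, and \<open>\<delta>\<^sub>k f\<close> vanishes below \<open>k\<close>.
  Hence the sequences \<open>D x \<delta>\<^sub>k\<close>, which are uniformly bounded in norm, agree with a single \<open>u\<close> in
  \<open>\<ell>\<^sup>1\<close> below \<open>k\<close>, and \<open>r(x) = - u\<close> works.
\<close>

section \<open>The closed graph theorem\<close>

lemma closed_graph_imp_bounded_linear:
  fixes L :: "'a::banach \<Rightarrow> 'b::banach"
  assumes lin: "linear L"
    and graph: "\<And>X x y. X \<longlonglongrightarrow> x \<Longrightarrow> (\<lambda>n. L (X n)) \<longlonglongrightarrow> y \<Longrightarrow> L x = y"
  shows "bounded_linear L"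
proof -
  \<comment> \<open>By Baire some \<open>V n\<close> has interior, so every \<open>y\<close> is approximated arbitrarily well by some
    \<open>u\<close> with \<open>norm (L u) \<le> C * norm y\<close>; iterating this on the error writes \<open>x\<close> as the sum of a
    series on which \<open>L\<close> converges absolutely, and the closed graph identifies the limit.\<close>
  define V where "V n = closure {x. norm (L x) \<le> real n}" for n :: nat
  have "x \<in> \<Union>(range V)" for x
  proof -
    obtain n :: nat where "norm (L x) \<le> real n" using real_arch_simple by blast
    then show ?thesis by (auto simp: V_def intro: closure_subset[THEN subsetD])
  qed
  then have cover: "\<Union>(range V) = UNIV" by blast
  have "\<exists>n. interior (V n) \<noteq> {}"
  proof (rule ccontr)
    assume "\<not> ?thesis"
    then have "euclidean interior_of \<Union>(range V) = {}"
      by (intro Baire_category_alt) (auto simp: V_def completely_metrizable_space_euclidean)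
    then show False by (simp add: cover)
  qed
  then obtain n x0 e where e: "e > 0" "ball x0 e \<subseteq> V n"
    by (metis ex_in_conv mem_interior)
  \<comment> \<open>Since \<open>y = (x0 + y) - x0\<close> with both points in \<open>V n\<close>,
    the difference of two approximants works; this accounts for the factor 2.\<close>
  have approx: "\<exists>u. norm (L u) \<le> 2 * real n \<and> norm (y - u) < d" if "norm y < e" "d > 0" for y d
  proof -
    have "x0 + y \<in> V n" "x0 \<in> V n" using e that by (auto simp: dist_norm intro!: subsetD[OF e(2)])
    then obtain u v where uv: "norm (L u) \<le> real n" "norm (L v) \<le> real n"
      "dist u (x0 + y) < d / 2" "dist v x0 < d / 2"
      using \<open>d > 0\<close> unfolding V_def closure_approachable by (metis half_gt_zero mem_Collect_eq)
    have "norm (y - (u - v)) = norm ((v - x0) - (u - (x0 + y)))" by (simp add: algebra_simps)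
    also have "\<dots> < d"
      using norm_triangle_ineq4[of "v - x0" "u - (x0 + y)"] uv(3,4) by (simp add: dist_norm)
    finally have "norm (y - (u - v)) < d" .
    moreover have "norm (L (u - v)) \<le> 2 * real n"
      using norm_triangle_ineq4[of "L u" "L v"] uv(1,2) by (simp add: linear_diff[OF lin])
    ultimately show ?thesis by blast
  qed
  \<comment> \<open>Scaling \<open>y\<close> by \<open>t = e / (2 * norm y)\<close> moves it into
    the ball; undoing this turns the bound \<open>2 * real n\<close> into
    \<open>2 * real n / t = C * norm y\<close>.\<close>
  define C where "C = 4 * real n / e"
  have C0: "C \<ge> 0" using e by (simp add: C_def)
  have "\<exists>u. norm (L u) \<le> C * norm y \<and> norm (y - u) < d" if "d > 0" for y d
  proof (cases "y = 0")
    case True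
    then show ?thesis using that by (intro exI[of _ 0]) (simp add: linear_0[OF lin])
  next
    case False
    define t where "t = e / (2 * norm y)"
    have t: "t > 0" "norm (t *\<^sub>R y) < e" using False e by (auto simp: t_def)
    from approx[OF t(2) mult_pos_pos[OF t(1) that]]
    obtain u where u: "norm (L u) \<le> 2 * real n" "norm (t *\<^sub>R y - u) < t * d"
      by blast
    have "y - (1 / t) *\<^sub>R u = (1 / t) *\<^sub>R (t *\<^sub>R y - u)" using t by (simp add: scaleR_diff_right)
    then have "norm (y - (1 / t) *\<^sub>R u) = norm (t *\<^sub>R y - u) / t" using t by simp
    also have "\<dots> < d" using u t by (simp add: divide_simps mult.commute)
    finally have "norm (y - (1 / t) *\<^sub>R u) < d" .
    moreover have "norm (L ((1 / t) *\<^sub>R u)) \<le> C * norm y"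
    proof -
      have "norm (L ((1 / t) *\<^sub>R u)) = norm (L u) / t" using t by (simp add: linear_scale[OF lin])
      also have "\<dots> \<le> 2 * real n / t" using u t by (simp add: divide_right_mono)
      also have "\<dots> = C * norm y" using False e by (simp add: t_def C_def)
      finally show ?thesis .
    qed
    ultimately show ?thesis by blast
  qed
  then have "\<forall>y d. \<exists>u. d > 0 \<longrightarrow> norm (L u) \<le> C * norm y \<and> norm (y - u) < d"
    by blast
  then obtain g where g: "\<And>y d. d > 0 \<Longrightarrow> norm (L (g y d)) \<le> C * norm y"
      "\<And>y d. d > 0 \<Longrightarrow> norm (y - g y d) < d"
    by metis
  have bound: "norm (L x) \<le> norm x * (2 * C)" for x
  proof (cases "x = 0")
    case True
    then show ?thesis by (simp add: linear_0[OF lin])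
  next
    case False
    \<comment> \<open>Each call of \<open>g\<close> corrects the current error \<open>x - s\<close>,
      with a tolerance that halves at every stage, so the norms of \<open>L (h k)\<close> are
      dominated by a geometric series with sum \<open>2 * C * norm x\<close>.\<close>
    define s where "s = rec_nat 0 (\<lambda>k s. s + g (x - s) (norm x * (1/2) ^ Suc k))"
    define h where "h k = g (x - s k) (norm x * (1/2) ^ Suc k)" for k
    have s_0: "s 0 = 0" and s_Suc: "s (Suc k) = s k + h k" for k
      by (simp_all add: s_def h_def)
    have pos: "norm x * (1/2) ^ Suc k > 0" for k using False by simp
    have dist_s: "norm (x - s k) \<le> norm x * (1/2) ^ k" for k
    proof (cases k)
      case (Suc j)
      then show ?thesis
        using g(2)[OF pos[of j], of "x - s j"] by (simp add: s_Suc h_def algebra_simps)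
    qed (simp add: s_0)
    have Lh: "norm (L (h k)) \<le> C * norm x * (1/2) ^ k" for k
    proof -
      have "norm (L (h k)) \<le> C * norm (x - s k)" unfolding h_def by (rule g(1)[OF pos])
      also have "\<dots> \<le> C * (norm x * (1/2) ^ k)" by (rule mult_left_mono[OF dist_s C0])
      finally show ?thesis by (simp add: mult.assoc)
    qed
    have geo: "(\<lambda>k. C * norm x * (1/2) ^ k) sums (C * norm x * 2)"
      using sums_mult[OF geometric_sums[of "1/2::real"], of "C * norm x"] by simp
    have sumn: "summable (\<lambda>k. norm (L (h k)))"
      by (rule summable_comparison_test'[OF sums_summable[OF geo]]) (simp add: Lh)
    have Ls: "L (s k) = (\<Sum>j<k. L (h j))" for k
      by (induction k) (simp_all add: s_0 s_Suc linear_0[OF lin] linear_add[OF lin])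
    have "(\<lambda>k. L (s k)) \<longlonglongrightarrow> (\<Sum>j. L (h j))"
      unfolding Ls by (rule summable_LIMSEQ[OF summable_norm_cancel[OF sumn]])
    moreover have "s \<longlonglongrightarrow> x"
    proof (rule LIMSEQ_I)
      fix r :: real assume "r > 0"
      have "(\<lambda>k. norm x * (1/2::real) ^ k) \<longlonglongrightarrow> norm x * 0"
        by (intro tendsto_intros LIMSEQ_power_zero) auto
      then have "\<forall>\<^sub>F k in sequentially. norm x * (1/2::real) ^ k < r"
        using \<open>r > 0\<close> by (auto dest: order_tendstoD)
      then show "\<exists>no. \<forall>k\<ge>no. norm (s k - x) < r"
        unfolding eventually_sequentially by (metis dist_s norm_minus_commute order_le_less_trans)
    qed
    ultimately have "L x = (\<Sum>j. L (h j))" by (rule graph[rotated])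
    also have "norm \<dots> \<le> (\<Sum>j. norm (L (h j)))" by (rule summable_norm[OF sumn])
    also have "\<dots> \<le> C * norm x * 2"
      using suminf_le[OF Lh sumn sums_summable[OF geo]] sums_unique[OF geo] by simp
    finally show ?thesis by (simp add: mult_ac)
  qed
  show ?thesis
    by (rule bounded_linear_intro[OF linear_add[OF lin] linear_scale[OF lin] bound])
qed

section \<open>Complex linear and bounded complex linear maps\<close>

lemma clinear_iff:
  "clinear f \<longleftrightarrow> (\<forall>x y. f (x + y) = f x + f y) \<and> (\<forall>c x. f (c *\<^sub>C x) = c *\<^sub>C f x)"
  by (simp add: clinear_def Vector_Spaces.linear_iff vector_space_scaleC)

lemma clinear_imp_linear: "clinear f \<Longrightarrow> linear f"
  by (rule linearI) (auto simp: clinear_iff simp flip: scaleC_of_real)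

lemma clinear_add: "clinear f \<Longrightarrow> f (x + y) = f x + f y"
  and clinear_scaleC: "clinear f \<Longrightarrow> f (c *\<^sub>C x) = c *\<^sub>C f x"
  by (simp_all add: clinear_iff)

lemmas clinear_diff = linear_diff[OF clinear_imp_linear]
lemmas clinear_0 = linear_0[OF clinear_imp_linear]

lemma scaleC_diff_right: "c *\<^sub>C (x - y) = c *\<^sub>C x - c *\<^sub>C (y::'a::complex_vector)"
  using scaleC_add_right[of c "x - y" y] by simp

lemma scaleC_minus_right: "c *\<^sub>C (- x) = - (c *\<^sub>C (x::'a::complex_vector))"
  using scaleC_diff_right[of c 0 x] scaleC_diff_right[of c 0 0] by simp

lemma scaleC_one [simp]: "1 *\<^sub>C x = (x::'a::complex_vector)"
  using scaleC_of_real[of 1 x] by simp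

lemma module_scaleC: "module (scaleC :: complex \<Rightarrow> 'a \<Rightarrow> 'a::complex_vector)"
  by (simp add: module_iff_vector_space vector_space_scaleC)

lemma csubspace_iff:
  "csubspace M \<longleftrightarrow> 0 \<in> M \<and> (\<forall>x\<in>M. \<forall>y\<in>M. x + y \<in> M) \<and> (\<forall>c. \<forall>x\<in>M. c *\<^sub>C x \<in> M)"
  by (simp add: csubspace_def module.subspace_def[OF module_scaleC])

lemma bounded_clinear_imp_clinear: "bounded_clinear f \<Longrightarrow> clinear f"
  and bounded_clinear_imp_bounded_linear: "bounded_clinear f \<Longrightarrow> bounded_linear f"
  by (simp_all add: bounded_clinear_def)

lemma bounded_clinearI:
  assumes "\<And>x y. f (x + y) = f x + f y" "\<And>c x. f (c *\<^sub>C x) = c *\<^sub>C f x"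
    and "\<And>x. norm (f x) \<le> norm x * K"
  shows "bounded_clinear f"
  unfolding bounded_clinear_def
proof
  show f: "clinear f" using assms by (simp add: clinear_iff)
  show "bounded_linear f"
    using clinear_imp_linear[OF f] assms(3)
    by (intro bounded_linear_intro) (auto simp: linear_add linear_scale)
qed

lemma bounded_clinear_compose:
  assumes "bounded_clinear f" "bounded_clinear g"
  shows "bounded_clinear (\<lambda>x. f (g x))"
  using assms by (auto simp: bounded_clinear_def clinear_iff intro: bounded_linear_compose)

lemma bounded_clinear_diff:
  assumes "bounded_clinear f" "bounded_clinear g"
  shows "bounded_clinear (\<lambda>x. f x - g x)"
  using assms by (auto simp: bounded_clinear_def clinear_iff scaleC_diff_right intro: bounded_linear_sub)

lemma bounded_clinear_add:
  assumes "bounded_clinear f" "bounded_clinear g"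
  shows "bounded_clinear (\<lambda>x. f x + g x)"
  using assms by (auto simp: bounded_clinear_def clinear_iff scaleC_add_right intro: bounded_linear_add)

lemma bounded_clinear_uminus: "bounded_clinear f \<Longrightarrow> bounded_clinear (\<lambda>x. - f x)"
  by (auto simp: bounded_clinear_def clinear_iff scaleC_minus_right intro: bounded_linear_minus)

lemma bounded_clinear_ident: "bounded_clinear (\<lambda>x. x)"
  by (simp add: bounded_clinear_def clinear_iff)

lemma bounded_clinear_scaleC: "bounded_clinear (\<lambda>x. c *\<^sub>C x)"
  by (rule bounded_clinearI[where K = "cmod c"])
    (simp_all add: scaleC_add_right scaleC_scaleC norm_scaleC mult.commute)

lemma bounded_clinear_bound:
  assumes "bounded_clinear f"
  obtains K where "K \<ge> 0" "\<And>x. norm (f x) \<le> K * norm x"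
  using bounded_linear.nonneg_bounded[OF bounded_clinear_imp_bounded_linear[OF assms]]
  by (metis mult.commute)

section \<open>Reduction of \<phi>-injectivity to inner derivations\<close>

lemma admissible_inj_left_inverse:
  fixes T :: "'f::complex_banach \<Rightarrow> 'k::complex_banach"
  assumes T: "admissible T" and "inj T"
  obtains L where "bounded_clinear L" "\<And>x. L (T x) = x"
proof -
  have bT: "bounded_clinear T" using T by (simp add: admissible_def)
  note cT = bounded_clinear_imp_clinear[OF bT]
  obtain N where N: "csubspace N" "closed N" "range T \<inter> N = {0}"
      and dec: "\<And>x. \<exists>m\<in>range T. \<exists>n\<in>N. x = m + n"
    using T by (auto simp: admissible_def closed_complemented_def)
  have N_add: "x + y \<in> N" and N_scale: "c *\<^sub>C x \<in> N" if "x \<in> N" "y \<in> N" for x y c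
    using N(1) that by (auto simp: csubspace_iff)
  have N_diff: "x - y \<in> N" if "x \<in> N" "y \<in> N" for x y
  proof -
    have "(-1) *\<^sub>C y = - y" using scaleC_of_real[of "-1" y] by simp
    then show ?thesis using N_add[OF that(1) N_scale[OF that(2) that(2), of "-1"]] by simp
  qed
  have ex: "\<exists>f. x - T f \<in> N" for x
    using dec[of x] by (metis add_diff_cancel_left' imageE)
  \<comment> \<open>\<open>L x\<close> will be the preimage under \<open>T\<close> of the projection
    of \<open>x\<close> to \<open>range T\<close> along \<open>N\<close>. By uniqueness, each
    property of \<open>L\<close> reduces to a membership in \<open>N\<close>.\<close>
  have uniq: "f = g" if "x - T f \<in> N" "x - T g \<in> N" for x f g
  proof -
    have "T (f - g) \<in> N" using N_diff[OF that(2,1)] by (simp add: clinear_diff[OF cT])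
    then have "T (f - g) = 0" using N(3) by blast
    then have "T f = T g" by (simp add: clinear_diff[OF cT])
    then show ?thesis using \<open>inj T\<close> by (simp add: inj_eq)
  qed
  obtain L where L: "\<And>x. x - T (L x) \<in> N" using ex by metis
  have clin: "clinear L"
    unfolding clinear_iff
  proof (intro conjI allI)
    fix x y :: 'k and c :: complex
    show "L (x + y) = L x + L y"
      using N_add[OF L[of x] L[of y]]
      by (intro uniq[OF L]) (simp add: clinear_add[OF cT] algebra_simps)
    show "L (c *\<^sub>C x) = c *\<^sub>C L x"
      using N_scale[OF L[of x] L[of x], of c]
      by (intro uniq[OF L]) (simp add: clinear_scaleC[OF cT] scaleC_diff_right)
  qed
  \<comment> \<open>The graph of \<open>L\<close> is closed because \<open>N\<close> is closed and
    \<open>T\<close> is continuous.\<close>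
  have "bounded_linear L"
  proof (rule closed_graph_imp_bounded_linear[OF clinear_imp_linear[OF clin]])
    fix X x y assume X: "X \<longlonglongrightarrow> x" "(\<lambda>n. L (X n)) \<longlonglongrightarrow> y"
    have "(\<lambda>n. X n - T (L (X n))) \<longlonglongrightarrow> x - T y"
      by (intro tendsto_diff X bounded_linear.tendsto[OF bounded_clinear_imp_bounded_linear[OF bT]])
    then have "x - T y \<in> N"
      by (rule closed_sequentially[OF N(2) L])
    then show "L x = y" by (intro uniq[OF L])
  qed
  moreover have "L (T x) = x" for x
    using N(1) by (intro uniq[OF L]) (simp add: csubspace_iff)
  ultimately show ?thesis using clin that by (simp add: bounded_clinear_def)
qed

text \<open>To a morphism \<open>S\<close> one attaches the derivation that applies \<open>S\<close>
  after \<open>L\<close> to the defect \<open>a x - \<phi>(a) x\<close>; its innerness supplies the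
  correction of \<open>S\<close> after \<open>L\<close> on the kernel of \<open>L\<close>. As
  \<open>characters\<close> does not include continuity, the bound contains
  \<open>cmod (\<phi> a)\<close> itself.\<close>

lemma char_injectiveI:
  fixes \<phi> :: "'a::complex_banach_algebra \<Rightarrow> complex" and actE :: "'a \<Rightarrow> 'e::complex_banach \<Rightarrow> 'e"
  assumes \<phi>: "\<phi> \<in> characters" and E: "banach_left_module actE"
    and derivation_inner: "\<And>D :: 'k::complex_banach \<Rightarrow> 'a \<Rightarrow> 'e.
      \<lbrakk>\<And>a. bounded_clinear (\<lambda>x. D x a); \<And>x. clinear (D x);
       \<And>x a b. D x (a * b) = actE a (D x b) + \<phi> b *\<^sub>C D x a;
       \<exists>C. \<forall>x a. norm (D x a) \<le> C * (norm a + cmod (\<phi> a)) * norm x\<rbrakk>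
      \<Longrightarrow> \<exists>r. bounded_clinear r \<and> (\<forall>x a. D x a = actE a (r x) - \<phi> a *\<^sub>C r x)"
  shows "char_injective TYPE('f::complex_banach) TYPE('k) \<phi> actE"
  unfolding char_injective_def
proof (intro conjI allI impI E equalityI subsetI)
  fix actF :: "'a \<Rightarrow> 'f \<Rightarrow> 'f" and actK :: "'a \<Rightarrow> 'k \<Rightarrow> 'k" and T S
  assume F: "banach_left_module actF" and K: "banach_left_module actK"
    and T: "T \<in> module_morphisms actF actK" "inj T" "admissible T"
    and I: "I_char \<phi> actK \<subseteq> range T"
  have bT: "bounded_clinear T" and T_act: "\<And>a x. T (actF a x) = actK a (T x)"
    using T(1) by (auto simp: module_morphisms_def)
  note cT = bounded_clinear_imp_clinear[OF bT]
  {
    assume "S \<in> (\<lambda>R. R \<circ> T) ` module_morphisms actK actE"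
    then show "S \<in> module_morphisms actF actE"
      using bT T_act by (auto simp: module_morphisms_def o_def intro: bounded_clinear_compose)
  }
  assume "S \<in> module_morphisms actF actE"
  then have bS: "bounded_clinear S" and S_act: "\<And>a x. S (actF a x) = actE a (S x)"
    by (auto simp: module_morphisms_def)
  note cS = bounded_clinear_imp_clinear[OF bS]
  obtain L where bL: "bounded_clinear L" and LT: "\<And>x. L (T x) = x"
    using admissible_inj_left_inverse[OF T(3,2)] by blast
  note cL = bounded_clinear_imp_clinear[OF bL]
  have \<phi>_mult: "\<phi> (a * b) = \<phi> a * \<phi> b" and c\<phi>: "clinear \<phi>" for a b
    using \<phi> by (auto simp: characters_def)
  have \<phi>_add: "\<phi> (a + b) = \<phi> a + \<phi> b" and \<phi>_scale: "\<phi> (c *\<^sub>C a) = c * \<phi> a" for a b c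
    using clinear_add[OF c\<phi>] clinear_scaleC[OF c\<phi>] by (simp_all add: scaleC_complex_def)
  obtain C where C: "\<And>a x. norm (actK a x) \<le> C * norm a * norm x"
    and cK: "\<And>a. clinear (actK a)" and cK': "\<And>x. clinear (\<lambda>a. actK a x)"
    and K_mult: "\<And>a b x. actK (a * b) x = actK a (actK b x)"
    using K by (auto simp: banach_left_module_def)
  have cE: "clinear (actE a)" for a using E by (simp add: banach_left_module_def)
  have bK: "bounded_clinear (actK a)" for a
    by (rule bounded_clinearI[where K = "C * norm a"])
      (use C[of a] in \<open>simp_all add: clinear_add[OF cK] clinear_scaleC[OF cK] mult.commute\<close>)
  define \<delta> where "\<delta> x a = actK a x - \<phi> a *\<^sub>C x" for x a
  \<comment> \<open>This is where the inclusion of \<open>I_char\<close> in \<open>range T\<close>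
    enters: \<open>T\<close> after \<open>L\<close> is the identity on
    \<open>range T\<close>.\<close>
  have T\<delta>: "T (L (\<delta> x a)) = \<delta> x a" for x a
  proof -
    have "\<delta> x a \<in> I_char \<phi> actK"
      unfolding I_char_def cspan_def \<delta>_def by (rule module.span_base[OF module_scaleC]) blast
    then show ?thesis using I LT by (metis imageE subsetD)
  qed
  define D where "D x a = S (L (\<delta> x a))" for x a
  have "\<exists>r. bounded_clinear r \<and> (\<forall>x a. D x a = actE a (r x) - \<phi> a *\<^sub>C r x)"
  proof (rule derivation_inner)
    show "bounded_clinear (\<lambda>x. D x a)" for a
      unfolding D_def \<delta>_def
      by (intro bounded_clinear_compose[OF bS] bounded_clinear_compose[OF bL]
          bounded_clinear_diff bK bounded_clinear_scaleC)
    show "clinear (D x)" for x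
    proof -
      have "\<delta> x (a + b) = \<delta> x a + \<delta> x b" "\<delta> x (c *\<^sub>C a) = c *\<^sub>C \<delta> x a" for a b c
        by (simp_all add: \<delta>_def clinear_add[OF cK'] clinear_scaleC[OF cK'] \<phi>_add \<phi>_scale
            scaleC_add_left scaleC_diff_right scaleC_scaleC)
      then show ?thesis
        by (simp add: D_def clinear_iff clinear_add[OF cL] clinear_add[OF cS]
            clinear_scaleC[OF cL] clinear_scaleC[OF cS])
    qed
    show "D x (a * b) = actE a (D x b) + \<phi> b *\<^sub>C D x a" for x a b
    proof -
      have "\<delta> x (a * b) = actK a (\<delta> x b) + \<phi> b *\<^sub>C \<delta> x a"
        by (simp add: \<delta>_def K_mult \<phi>_mult clinear_diff[OF cK] clinear_scaleC[OF cK]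
            scaleC_diff_right scaleC_scaleC mult.commute)
      \<comment> \<open>In general \<open>L\<close> need not commute with the actions, but on
        \<open>range T\<close> it does, and \<open>\<delta> x b\<close> lies there.\<close>
      also have "actK a (\<delta> x b) = T (actF a (L (\<delta> x b)))" by (simp add: T_act T\<delta>)
      finally show ?thesis
        by (simp add: D_def clinear_add[OF cL] clinear_add[OF cS] clinear_scaleC[OF cL]
            clinear_scaleC[OF cS] LT S_act)
    qed
    obtain M where M: "M \<ge> 0" "\<And>x. norm (S (L x)) \<le> M * norm x"
      using bounded_clinear_bound[OF bounded_clinear_compose[OF bS bL]] by blast
    \<comment> \<open>The factor \<open>max C 1\<close> dominates both the module constant
      \<open>C\<close> and the coefficient 1 of the \<phi>-term.\<close>
    have "norm (D x a) \<le> M * (max C 1) * (norm a + cmod (\<phi> a)) * norm x" for x a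
    proof -
      have "norm (\<delta> x a) \<le> C * norm a * norm x + cmod (\<phi> a) * norm x"
        unfolding \<delta>_def using norm_triangle_ineq4[of "actK a x" "\<phi> a *\<^sub>C x"] C[of a x]
        by (simp add: norm_scaleC)
      also have "\<dots> \<le> max C 1 * (norm a * norm x) + max C 1 * (cmod (\<phi> a) * norm x)"
        using mult_right_mono[of C "max C 1" "norm a * norm x"]
          mult_right_mono[of 1 "max C 1" "cmod (\<phi> a) * norm x"] by (simp add: mult.assoc)
      finally have "norm (\<delta> x a) \<le> max C 1 * ((norm a + cmod (\<phi> a)) * norm x)"
        by (simp add: algebra_simps)
      from mult_left_mono[OF this M(1)] M(2)[of "\<delta> x a"] show ?thesis
        by (simp add: D_def mult.assoc)
    qed
    then show "\<exists>C. \<forall>x a. norm (D x a) \<le> C * (norm a + cmod (\<phi> a)) * norm x" by blast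
  qed
  then obtain r where r: "bounded_clinear r" and Dr: "\<And>x a. D x a = actE a (r x) - \<phi> a *\<^sub>C r x"
    by blast
  note cr = bounded_clinear_imp_clinear[OF r]
  define R where "R x = S (L x) + r (x - T (L x))" for x
  have "bounded_clinear R"
    unfolding R_def
    by (intro bounded_clinear_add bounded_clinear_compose[OF bS] bounded_clinear_compose[OF r]
        bounded_clinear_diff bounded_clinear_ident bounded_clinear_compose[OF bT] bL)
  moreover have "R (actK a x) = actE a (R x)" for a x
  proof -
    \<comment> \<open>\<open>y\<close> is the component of \<open>x\<close> in the kernel of
      \<open>L\<close>. Acting by \<open>a\<close> multiplies it by \<open>\<phi> a\<close> up to
      the defect \<open>T g\<close>, and \<open>S g = D y a\<close> is exactly what \<open>r\<close>
      fails to intertwine.\<close>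
    define y where "y = x - T (L x)"
    define g where "g = L (\<delta> y a)"
    have Ly: "L y = 0" by (simp add: y_def clinear_diff[OF cL] LT)
    have "actK a x = actK a (T (L x)) + actK a y"
      by (simp add: y_def flip: clinear_add[OF cK])
    also have "actK a (T (L x)) = T (actF a (L x))" by (simp add: T_act)
    also have "actK a y = T g + \<phi> a *\<^sub>C y" by (simp add: g_def T\<delta>, simp add: \<delta>_def)
    finally have ax: "actK a x = T (actF a (L x)) + (T g + \<phi> a *\<^sub>C y)" .
    have Lax: "L (actK a x) = actF a (L x) + g"
      by (simp add: ax clinear_add[OF cL] clinear_scaleC[OF cL] LT Ly)
        (metis Ly clinear_scaleC[OF cL] clinear_0[OF cL] diff_self scaleC_diff_right)
    have "actK a x - T (L (actK a x)) = \<phi> a *\<^sub>C y"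
      unfolding Lax by (simp add: ax clinear_add[OF cT])
    then have "R (actK a x) = actE a (S (L x)) + S g + \<phi> a *\<^sub>C r y"
      by (simp add: R_def Lax clinear_add[OF cS] S_act clinear_scaleC[OF cr])
    also have "S g = actE a (r y) - \<phi> a *\<^sub>C r y" by (simp add: g_def Dr flip: D_def)
    finally show ?thesis by (simp add: R_def y_def clinear_add[OF cE])
  qed
  ultimately have "R \<in> module_morphisms actK actE" by (simp add: module_morphisms_def)
  moreover have "S = R \<circ> T" by (rule ext) (simp add: R_def LT clinear_0[OF cr])
  ultimately show "S \<in> (\<lambda>R. R \<circ> T) ` module_morphisms actK actE" by blast
qed

text \<open>Expanding \<open>D x (a * p)\<close> by the derivation rule and by
  \<open>a * p = \<phi> a *\<^sub>C p\<close> expresses \<open>D x a\<close> through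
  \<open>D x p\<close> alone.\<close>

lemma char_injective_if_eigenvector:
  fixes \<phi> :: "'a::complex_banach_algebra \<Rightarrow> complex" and actE :: "'a \<Rightarrow> 'e::complex_banach \<Rightarrow> 'e"
  assumes \<phi>: "\<phi> \<in> characters" and E: "banach_left_module actE"
    and p: "\<And>a. a * p = \<phi> a *\<^sub>C p" "\<phi> p = 1"
  shows "char_injective TYPE('f::complex_banach) TYPE('k::complex_banach) \<phi> actE"
proof (rule char_injectiveI[OF \<phi> E])
  fix D :: "'k \<Rightarrow> 'a \<Rightarrow> 'e"
  assume D: "\<And>a. bounded_clinear (\<lambda>x. D x a)" "\<And>x. clinear (D x)"
    "\<And>x a b. D x (a * b) = actE a (D x b) + \<phi> b *\<^sub>C D x a"
  have cE: "clinear (actE a)" for a using E by (simp add: banach_left_module_def)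
  have "D x a = actE a (- D x p) - \<phi> a *\<^sub>C (- D x p)" for x a
  proof -
    have "\<phi> a *\<^sub>C D x p = D x (a * p)" by (simp add: p(1) clinear_scaleC[OF D(2)])
    also have "\<dots> = actE a (D x p) + D x a" by (simp add: D(3) p(2))
    finally show ?thesis
      by (simp add: linear_neg[OF clinear_imp_linear[OF cE]] scaleC_minus_right)
  qed
  then show "\<exists>r. bounded_clinear r \<and> (\<forall>x a. D x a = actE a (r x) - \<phi> a *\<^sub>C r x)"
    using bounded_clinear_uminus[OF D(1)[of p]] by blast
qed

section \<open>Point masses and the semigroup \<open>nat_vee\<close>\<close>

lift_definition l1_delta :: "'s \<Rightarrow> 's l1" is "\<lambda>k s. if s = k then 1 else 0"
  by (rule finite_nonzero_values_imp_summable_on) simp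

lemma norm_l1_delta: "norm (l1_delta k) \<le> 1"
proof (rule norm_l1_le)
  fix A :: "'a set" assume "finite A"
  then show "(\<Sum>s\<in>A. cmod (l1_fun (l1_delta k) s)) \<le> 1"
    by (simp add: l1_delta.rep_eq if_distrib[of cmod] sum.delta cong: if_cong)
qed

lemma l1_fun_mult_delta:
  fixes f :: "'s::semigroup_mult l1"
  shows "l1_fun (f * l1_delta k) s = (\<Sum>\<^sub>\<infinity>u\<in>{u. u * k = s}. l1_fun f u)"
proof -
  have bij: "bij_betw (\<lambda>u. (u, k)) {u. u * k = s} {(u, v). v = k \<and> u * v = s}"
    by (rule bij_betwI[where g = fst]) auto
  have "l1_fun (f * l1_delta k) s =
      (\<Sum>\<^sub>\<infinity>p\<in>{(u, v). u * v = s}. l1_fun f (fst p) * l1_fun (l1_delta k) (snd p))"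
    by (simp add: times_l1.rep_eq convolution_def case_prod_unfold)
  also have "\<dots> = (\<Sum>\<^sub>\<infinity>p\<in>{(u, v). v = k \<and> u * v = s}. l1_fun f (fst p))"
    by (rule infsum_cong_neutral) (auto simp: l1_delta.rep_eq)
  also have "\<dots> = (\<Sum>\<^sub>\<infinity>u\<in>{u. u * k = s}. l1_fun f u)"
    using infsum_reindex_bij_betw[OF bij, of "\<lambda>p. l1_fun f (fst p)"] by simp
  finally show ?thesis .
qed

lemma l1_mult_commute:
  fixes f g :: "'s::semigroup_mult l1"
  assumes "\<And>u v :: 's. u * v = v * u"
  shows "f * g = g * f"
proof (rule l1_eqI)
  fix s :: 's
  have bij: "bij_betw prod.swap {(u, v). u * v = s} {(u, v). u * v = s}"
    by (rule bij_betwI[where g = prod.swap]) (auto simp: assms)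
  show "l1_fun (f * g) s = l1_fun (g * f) s"
    using infsum_reindex_bij_betw[OF bij, of "\<lambda>(u, v). l1_fun g u * l1_fun f v"]
    by (simp add: times_l1.rep_eq convolution_def case_prod_unfold mult.commute)
qed

lemma Rep_nat_vee_mult: "Rep_nat_vee (u * v) = max (Rep_nat_vee u) (Rep_nat_vee v)"
  by (rule times_nat_vee.rep_eq)

lemma nat_vee_mult_commute: "u * v = v * (u::nat_vee)"
  by transfer (rule max.commute)

lift_definition nat_vee_Suc :: "nat_vee \<Rightarrow> nat_vee" is Suc by simp

lift_definition nat_vee_one :: nat_vee is 1 by simp

lemma nat_vee_induct:
  assumes "P nat_vee_one" "\<And>m. P m \<Longrightarrow> P (nat_vee_Suc m)"
  shows "P k"
proof -
  have "n \<ge> 1 \<Longrightarrow> P (Abs_nat_vee n)" for n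
  proof (induction n rule: nat_induct_at_least)
    case base
    then show ?case using assms(1) by (simp add: nat_vee_one_def)
  next
    case (Suc n)
    then show ?case
      using assms(2)[of "Abs_nat_vee n"] by (simp add: nat_vee_Suc.abs_eq eq_onp_def)
  qed
  then show ?thesis by (metis Abs_nat_vee_cases mem_Collect_eq)
qed

lemma finite_nat_vee_bounded: "finite {u. Rep_nat_vee u \<le> n}"
proof (rule finite_imageD)
  show "finite (Rep_nat_vee ` {u. Rep_nat_vee u \<le> n})"
    by (rule finite_subset[of _ "{..n}"]) auto
qed (auto simp: inj_on_def Rep_nat_vee_inject)

lemma finite_nat_vee_obtain_upper:
  assumes "finite A"
  obtains k where "\<And>i. i \<in> A \<Longrightarrow> Rep_nat_vee i < Rep_nat_vee k"
proof -
  \<comment> \<open>Inserting 0 covers empty \<open>A\<close>; \<open>Suc\<close> makes the bound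
    strict and puts \<open>n\<close> in the carrier of \<open>nat_vee\<close>.\<close>
  define n where "n = Suc (Max (insert 0 (Rep_nat_vee ` A)))"
  have "Rep_nat_vee i < Rep_nat_vee (Abs_nat_vee n)" if "i \<in> A" for i
    using assms that by (simp add: n_def Abs_nat_vee_inverse less_Suc_eq_le)
  then show ?thesis using that by blast
qed

lemma nat_vee_delta_fibre:
  "{u. u * k = s} = (if Rep_nat_vee s < Rep_nat_vee k then {} else if s = k
     then {u. Rep_nat_vee u \<le> Rep_nat_vee k} else {s})"
  by (auto simp: Rep_nat_vee_mult simp flip: Rep_nat_vee_inject)

lemma l1_fun_nat_vee_mult_delta:
  "l1_fun (f * l1_delta k) s = (if Rep_nat_vee s < Rep_nat_vee k then 0 else if s = k
     then (\<Sum>u | Rep_nat_vee u \<le> Rep_nat_vee k. l1_fun f u) else l1_fun f s)"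
  by (simp add: l1_fun_mult_delta nat_vee_delta_fibre finite_nat_vee_bounded)

lemma mult_l1_delta_one: "f * l1_delta nat_vee_one = f"
proof (rule l1_eqI)
  fix s
  have "{u. u * nat_vee_one = s} = {s}"
    by (transfer, auto simp: max_def)
  then show "l1_fun (f * l1_delta nat_vee_one) s = l1_fun f s"
    by (simp add: l1_fun_mult_delta)
qed

lemma l1_delta_nat_vee_idem: "l1_delta k * l1_delta k = l1_delta (k::nat_vee)"
  by (rule l1_eqI) (auto simp: l1_fun_nat_vee_mult_delta l1_delta.rep_eq sum.delta' finite_nat_vee_bounded)

text \<open>If \<open>u * v = i\<close> then \<open>v\<close> is at most \<open>i\<close>, so larger
  entries of the second factor never reach entry \<open>i\<close>.\<close>

lemma l1_nat_vee_mult_local: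
  assumes "\<And>j. Rep_nat_vee j \<le> Rep_nat_vee i \<Longrightarrow> l1_fun f j = l1_fun g j"
  shows "l1_fun (a * f) i = l1_fun (a * g) i"
  unfolding times_l1.rep_eq convolution_def
  by (rule infsum_cong) (auto simp: Rep_nat_vee_mult assms)

text \<open>The products of \<open>a\<close> with the two point masses both vanish below
  \<open>m\<close> and both equal \<open>a\<close> above \<open>m + 1\<close>. At
  \<open>m + 1\<close> the entry of \<open>a\<close> cancels against the last summand of the longer
  partial sum.\<close>

lemma l1_nat_vee_eigenvector:
  fixes m :: nat_vee
  defines "p \<equiv> l1_delta m - l1_delta (nat_vee_Suc m)"
  shows "a * p = (\<Sum>u | Rep_nat_vee u \<le> Rep_nat_vee m. l1_fun a u) *\<^sub>C p"
proof (rule l1_eqI)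
  fix s
  have *: "{u. Rep_nat_vee u \<le> Suc (Rep_nat_vee m)} =
      insert (nat_vee_Suc m) {u. Rep_nat_vee u \<le> Rep_nat_vee m}"
    by (auto simp: nat_vee_Suc.rep_eq simp flip: Rep_nat_vee_inject)
  show "l1_fun (a * p) s = l1_fun ((\<Sum>u | Rep_nat_vee u \<le> Rep_nat_vee m. l1_fun a u) *\<^sub>C p) s"
    by (auto simp: p_def right_diff_distrib minus_l1.rep_eq scaleC_l1.rep_eq l1_delta.rep_eq
        l1_fun_nat_vee_mult_delta nat_vee_Suc.rep_eq * finite_nat_vee_bounded simp flip: Rep_nat_vee_inject)
      (auto simp: nat_vee_Suc.rep_eq intro!: arg_cong[of _ _ "l1_fun a"] simp flip: Rep_nat_vee_inject)
qed

section \<open>The algebra as a module, and the character equal to 1 on all point masses\<close>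

lemma banach_left_module_mult: "banach_left_module ((*) :: 'a::complex_banach_algebra \<Rightarrow> 'a \<Rightarrow> 'a)"
  unfolding banach_left_module_def
  by (auto simp: clinear_iff distrib_left distrib_right mult_scaleC_left mult_scaleC_right mult.assoc
      intro!: exI[of _ 1] norm_mult_ineq)

lemma char_injective_l1_nat_vee_top:
  fixes \<phi> :: "nat_vee l1 \<Rightarrow> complex"
  assumes \<phi>: "\<phi> \<in> characters" and \<phi>_delta: "\<And>k. \<phi> (l1_delta k) = 1"
  shows "char_injective TYPE('f::complex_banach) TYPE('k::complex_banach) \<phi>
           ((*) :: nat_vee l1 \<Rightarrow> nat_vee l1 \<Rightarrow> nat_vee l1)"
proof (rule char_injectiveI[OF \<phi> banach_left_module_mult])
  fix D :: "'k \<Rightarrow> nat_vee l1 \<Rightarrow> nat_vee l1"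
  assume D: "\<And>a. bounded_clinear (\<lambda>x. D x a)"
    and D_mult: "\<And>x a b. D x (a * b) = a * D x b + \<phi> b *\<^sub>C D x a"
    and "\<exists>C. \<forall>x a. norm (D x a) \<le> C * (norm a + cmod (\<phi> a)) * norm x"
  then obtain C where C: "\<And>x a. norm (D x a) \<le> C * (norm a + cmod (\<phi> a)) * norm x" by blast
  have commute: "a * b = b * a" for a b :: "nat_vee l1"
    by (rule l1_mult_commute[OF nat_vee_mult_commute])
  \<comment> \<open>Expand \<open>D x\<close> of the same product in both orders; the term
    \<open>D x a * l1_delta k\<close> vanishes at \<open>i\<close> below \<open>k\<close>.\<close>
  have D_at: "l1_fun (D x a) i = \<phi> a * l1_fun (D x (l1_delta k)) i - l1_fun (a * D x (l1_delta k)) i"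
    if "Rep_nat_vee i < Rep_nat_vee k" for x a i k
  proof -
    have "a * D x (l1_delta k) + D x a = D x (l1_delta k * a)"
      by (simp add: D_mult \<phi>_delta flip: commute[of a "l1_delta k"])
    also have "\<dots> = D x a * l1_delta k + \<phi> a *\<^sub>C D x (l1_delta k)"
      by (simp add: D_mult commute[of _ "D x a"])
    finally have "l1_fun (a * D x (l1_delta k) + D x a) i
        = l1_fun (D x a * l1_delta k + \<phi> a *\<^sub>C D x (l1_delta k)) i" by simp
    then show ?thesis
      using that by (simp add: plus_l1.rep_eq scaleC_l1.rep_eq l1_fun_nat_vee_mult_delta algebra_simps)
  qed
  \<comment> \<open>The successor of \<open>i\<close> is the least \<open>k\<close> strictly above
    \<open>i\<close>, hence the first one at which entry \<open>i\<close> has stabilised.\<close>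
  define u where "u x i = l1_fun (D x (l1_delta (nat_vee_Suc i))) i" for x i
  have u: "l1_fun (D x (l1_delta k)) i = u x i" if "Rep_nat_vee i < Rep_nat_vee k" for x i k
    using D_at[OF that, of x "l1_delta (nat_vee_Suc i)"]
    by (simp add: u_def \<phi>_delta commute[of "l1_delta _"] l1_fun_nat_vee_mult_delta nat_vee_Suc.rep_eq)
  \<comment> \<open>One \<open>k\<close> above all of \<open>A\<close> computes every entry
    involved, and the 2 bounds \<open>norm (l1_delta k) + 1\<close>.\<close>
  have bound: "(\<Sum>i\<in>A. cmod (u x i)) \<le> norm x * (max C 0 * 2)" if A: "finite A" for A x
  proof -
    obtain k where "\<And>i. i \<in> A \<Longrightarrow> Rep_nat_vee i < Rep_nat_vee k"
      using finite_nat_vee_obtain_upper[OF A] by blast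
    then have "(\<Sum>i\<in>A. cmod (u x i)) = (\<Sum>i\<in>A. cmod (l1_fun (D x (l1_delta k)) i))"
      by (intro sum.cong) (auto simp: u)
    also have "\<dots> \<le> norm (D x (l1_delta k))" by (rule norm_l1_ge[OF A])
    also have "\<dots> \<le> C * (norm (l1_delta k) + 1) * norm x"
      using C[of x "l1_delta k"] by (simp add: \<phi>_delta)
    also have "\<dots> \<le> max C 0 * 2 * norm x"
      by (intro mult_right_mono mult_mono) (use norm_l1_delta[of k] in auto)
    finally show ?thesis by (simp add: mult_ac)
  qed
  have "(\<lambda>i. cmod (u x i)) summable_on UNIV" for x
    unfolding abs_summable_iff_bdd_above
    by (rule bdd_aboveI[of _ "norm x * (max C 0 * 2)"]) (use bound in auto)
  then have U: "l1_fun (Abs_l1 (u x)) = u x" for x by (simp add: Abs_l1_inverse)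
  have "bounded_clinear (\<lambda>x. Abs_l1 (u x))"
  proof (rule bounded_clinearI)
    show "Abs_l1 (u (x + y)) = Abs_l1 (u x) + Abs_l1 (u y)" for x y
      by (rule l1_eqI)
        (simp add: U plus_l1.rep_eq u_def clinear_add[OF bounded_clinear_imp_clinear[OF D]])
    show "Abs_l1 (u (c *\<^sub>C x)) = c *\<^sub>C Abs_l1 (u x)" for c x
      by (rule l1_eqI)
        (simp add: U scaleC_l1.rep_eq u_def clinear_scaleC[OF bounded_clinear_imp_clinear[OF D]])
    show "norm (Abs_l1 (u x)) \<le> norm x * (max C 0 * 2)" for x
      by (rule norm_l1_le) (simp add: U bound)
  qed
  then have "bounded_clinear (\<lambda>x. - Abs_l1 (u x))" by (rule bounded_clinear_uminus)
  moreover have "D x a = a * (- Abs_l1 (u x)) - \<phi> a *\<^sub>C (- Abs_l1 (u x))" for x a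
  proof (rule l1_eqI)
    fix i
    have "l1_fun (a * D x (l1_delta (nat_vee_Suc i))) i = l1_fun (a * Abs_l1 (u x)) i"
      by (rule l1_nat_vee_mult_local) (simp add: U u nat_vee_Suc.rep_eq)
    then show "l1_fun (D x a) i = l1_fun (a * (- Abs_l1 (u x)) - \<phi> a *\<^sub>C (- Abs_l1 (u x))) i"
      using D_at[of i "nat_vee_Suc i" x a]
      by (simp add: nat_vee_Suc.rep_eq u_def U scaleC_minus_right minus_l1.rep_eq uminus_l1.rep_eq plus_l1.rep_eq
          scaleC_l1.rep_eq)
  qed
  ultimately show "\<exists>r. bounded_clinear r \<and> (\<forall>x a. D x a = a * r x - \<phi> a *\<^sub>C r x)" by blast
qed

section \<open>Values of a character on point masses and the case distinction\<close>

theorem theorem3p3: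
  fixes \<phi> :: "nat_vee l1 \<Rightarrow> complex"
  assumes "\<phi> \<in> characters"
  shows "char_injective TYPE('f::complex_banach) TYPE('k::complex_banach) \<phi>
           ((*) :: nat_vee l1 \<Rightarrow> nat_vee l1 \<Rightarrow> nat_vee l1)"
proof (cases "\<forall>k. \<phi> (l1_delta k) = 1")
  case True
  then show ?thesis by (intro char_injective_l1_nat_vee_top assms) auto
next
  case False
  have c: "clinear \<phi>" and mult: "\<phi> (a * b) = \<phi> a * \<phi> b" for a b
    using assms by (auto simp: characters_def)
  have "\<phi> (l1_delta k) * \<phi> (l1_delta k) = \<phi> (l1_delta k)" for k
    using mult[of "l1_delta k" "l1_delta k"] by (simp add: l1_delta_nat_vee_idem)
  then have zero_one: "\<phi> (l1_delta k) = 0 \<or> \<phi> (l1_delta k) = 1" for k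
    by (metis mult_cancel_left2)
  \<comment> \<open>\<open>l1_delta nat_vee_one\<close> is a unit, since 1 is the least element;
    this starts the induction that locates the drop from 1 to 0.\<close>
  obtain a where "\<phi> a \<noteq> 0" using assms by (auto simp: characters_def fun_eq_iff)
  then have "\<phi> (l1_delta nat_vee_one) = 1"
    using mult[of a "l1_delta nat_vee_one"] by (simp add: mult_l1_delta_one)
  with False obtain m where "\<phi> (l1_delta m) = 1" "\<phi> (l1_delta (nat_vee_Suc m)) = 0"
    using nat_vee_induct[of "\<lambda>k. \<phi> (l1_delta k) = 1"] zero_one by blast
  moreover define p where "p = l1_delta m - l1_delta (nat_vee_Suc m)"
  ultimately have \<phi>p: "\<phi> p = 1" by (simp add: clinear_diff[OF c])
  have "a * p = \<phi> a *\<^sub>C p" for a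
  proof -
    \<comment> \<open>Applying \<phi> to \<open>a * p = \<sigma> *\<^sub>C p\<close> identifies the
      partial sum \<sigma> with \<open>\<phi> a\<close>.\<close>
    define \<sigma> where "\<sigma> = (\<Sum>u | Rep_nat_vee u \<le> Rep_nat_vee m. l1_fun a u)"
    have ap: "a * p = \<sigma> *\<^sub>C p" unfolding \<sigma>_def p_def by (rule l1_nat_vee_eigenvector)
    have "\<phi> a = \<phi> (a * p)" by (simp add: mult \<phi>p)
    also have "\<dots> = \<sigma>" by (simp add: ap clinear_scaleC[OF c] \<phi>p scaleC_complex_def)
    finally show ?thesis by (simp add: ap)
  qed
  then show ?thesis
    by (rule char_injective_if_eigenvector[OF assms banach_left_module_mult _ \<phi>p])
qed

end
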